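(* For a monogenic semigroup $X=\{x^k\}_{k\in\mathbb N}$ the following conditions are equivalent: (1) the semigroup $\lambda(X)$ is supercommutative; (2) the semigroup $\lambda^\bullet(X)$ is supercommutative; (3) $x^n=x^m$ for some $(n,m)\in\{(1,2),(1,3),(2,3),(2,4),(3,4),(4,5)\}$.
   Context: $\mathbb N=\{1,2,3,\dots\}$. A semigroup is monogenic if it is generated by a single element $x$. An upfamily on a nonempty set $X$ is a nonempty family $\mathcal F$ of nonempty subsets of $X$ such that $F\in\mathcal F$ and $F\subset E\subset X$ imply $E\in\mathcal F$; $\upsilon(X)$ is the set of all upfamilies on $X$. A family $\mathcal G$ of nonempty subsets of $X$ generates the upfamily $\langle G:G\in\mathcal G\rangle=\{E\subset X:\exists G\in\mathcal G,\ G\subset E\}$. An upfamily $\mathcal F$ is linked if $A\cap B\ne\emptyset$ for all $A,B\in\mathcal F$; it is maximal linked if it is linked and coincides with every linked upfamily containing it. $\lambda(X)$ is the set of maximal linked upfamilies. An upfamily is finitely supported if it equals $\langle F_1,\dots,F_n\rangle$ for some (finitely many, at least one) nonempty finite sets $F_i\subset X$; $\lambda^\bullet(X)$ is the set of finitely supported maximal linked upfamilies. If $X$ is a semigroup, put for $\mathcal A,\mathcal B\in\upsilon(X)$: $\mathcal A*\mathcal B=\langle\bigcup_{a\in A}aB_a: A\in\mathcal A,\ (B_a)_{a\in A}\in\mathcal B^A\rangle$ and $\mathcal A\circledast\mathcal B=\langle AB:A\in\mathcal A,\ B\in\mathcal B\rangle$, where $AB=\{ab:a\in A,b\in B\}$.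 The operation $*$ is associative and $\lambda(X)$, $\lambda^\bullet(X)$ are subsemigroups of $(\upsilon(X),* )$. A subsemigroup $S$ of $(\upsilon(X),* )$ is supercommutative if $\mathcal A*\mathcal B=\mathcal A\circledast\mathcal B=\mathcal B\circledast\mathcal A=\mathcal B*\mathcal A$ for all $\mathcal A,\mathcal B\in S$. *)

theory Defs
  imports Main "HOL-Library.Set_Algebras"
begin

text \<open>The semigroup \<open>X\<close> is a type of class \<^class>\<open>semigroup_mult\<close>, so that subsets of \<open>X\<close>
  have type \<open>'a set\<close> and families of subsets have type \<open>'a set set\<close>. The products \<open>aB\<close> and \<open>AB\<close>
  of subsets are \<open>a *o B\<close> and \<open>A * B\<close> from \<^theory>\<open>HOL-Library.Set_Algebras\<close>.\<close>

text \<open>Powers \<open>x, x x, x x x, \<dots>\<close> in a semigroup without unit; meaningful for exponents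
  \<open>k \<ge> 1\<close> only (the value at \<open>0\<close> is a dummy).\<close>

definition spow :: "'a::semigroup_mult \<Rightarrow> nat \<Rightarrow> 'a" where
  "spow x k = (((*) x) ^^ (k - 1)) x"

lemma spow_1: "spow x 1 = x"
  by (simp add: spow_def)

lemma spow_Suc: "k \<ge> 1 \<Longrightarrow> spow x (Suc k) = x * spow x k"
  by (cases k) (simp_all add: spow_def)

lemma spow_add:
  assumes "j \<ge> 1" "k \<ge> 1"
  shows "spow x (j + k) = spow x j * spow x k"
  using assms(1)
proof (induction j rule: nat_induct_at_least)
  case base
  then show ?case using spow_Suc[OF assms(2)] spow_1[of x] by simp
next
  case (Suc j)
  then show ?case using spow_Suc[of "j + k" x] spow_Suc[of j x] by (simp add: mult.assoc)
qed

definition upfamilies :: "'a set set set" where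
  "upfamilies = {F. F \<noteq> {} \<and> {} \<notin> F \<and> (\<forall>A\<in>F. \<forall>E. A \<subseteq> E \<longrightarrow> E \<in> F)}"

definition generated_upfamily :: "'a set set \<Rightarrow> 'a set set" where
  "generated_upfamily G = {E. \<exists>A\<in>G. A \<subseteq> E}"

definition linked :: "'a set set \<Rightarrow> bool" where
  "linked F \<longleftrightarrow> (\<forall>A\<in>F. \<forall>B\<in>F. A \<inter> B \<noteq> {})"

definition maximal_linked_upfamilies :: "'a set set set" where
  "maximal_linked_upfamilies =
     {F \<in> upfamilies. linked F \<and> (\<forall>G\<in>upfamilies. linked G \<and> F \<subseteq> G \<longrightarrow> G = F)}"

definition finitely_supported :: "'a set set \<Rightarrow> bool" where
  "finitely_supported F \<longleftrightarrow>
     (\<exists>G. finite G \<and> G \<noteq> {} \<and> (\<forall>A\<in>G. finite A \<and> A \<noteq> {}) \<and> F = generated_upfamily G)"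

definition fs_maximal_linked_upfamilies :: "'a set set set" where
  "fs_maximal_linked_upfamilies = {F \<in> maximal_linked_upfamilies. finitely_supported F}"

definition up_star :: "'a::semigroup_mult set set \<Rightarrow> 'a set set \<Rightarrow> 'a set set"
    (infixl "\<star>" 70) where
  "\<A> \<star> \<B> = generated_upfamily {\<Union>a\<in>A. a *o B a |A B. A \<in> \<A> \<and> (\<forall>a\<in>A. B a \<in> \<B>)}"

definition up_prod :: "'a::semigroup_mult set set \<Rightarrow> 'a set set \<Rightarrow> 'a set set"
    (infixl "\<odot>" 70) where
  "\<A> \<odot> \<B> = generated_upfamily {A * B |A B. A \<in> \<A> \<and> B \<in> \<B>}"

text \<open>Used only for sets \<open>S\<close> of upfamilies closed under \<open>\<star>\<close>; the closure of the two sets that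
  occur below is proved in \<open>maximal_linked_star\<close> and \<open>fs_maximal_linked_star\<close>.\<close>

definition supercommutative :: "'a::semigroup_mult set set set \<Rightarrow> bool" where
  "supercommutative S \<longleftrightarrow>
     (\<forall>\<A>\<in>S. \<forall>\<B>\<in>S. \<A> \<star> \<B> = \<A> \<odot> \<B> \<and> \<A> \<odot> \<B> = \<B> \<odot> \<A> \<and> \<B> \<odot> \<A> = \<B> \<star> \<A>)"

lemma upfamilies_mono: "F \<in> upfamilies \<Longrightarrow> A \<in> F \<Longrightarrow> A \<subseteq> E \<Longrightarrow> E \<in> F"
  by (simp add: upfamilies_def)

lemma upfamilies_nonempty: "F \<in> upfamilies \<Longrightarrow> F \<noteq> {}"
  by (simp add: upfamilies_def)

lemma upfamilies_no_empty: "F \<in> upfamilies \<Longrightarrow> {} \<notin> F"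
  by (simp add: upfamilies_def)

lemma generated_upfamily_in_upfamilies:
  "G \<noteq> {} \<Longrightarrow> {} \<notin> G \<Longrightarrow> generated_upfamily G \<in> upfamilies"
  unfolding upfamilies_def generated_upfamily_def by (auto intro: order_trans)

lemma mem_star_iff:
  assumes "\<A> \<in> upfamilies" "\<B> \<in> upfamilies"
  shows "E \<in> \<A> \<star> \<B> \<longleftrightarrow> {a. {b. a * b \<in> E} \<in> \<B>} \<in> \<A>"
proof
  assume "E \<in> \<A> \<star> \<B>"
  then obtain A B where AB: "A \<in> \<A>" "\<forall>a\<in>A. B a \<in> \<B>" "(\<Union>a\<in>A. a *o B a) \<subseteq> E"
    unfolding up_star_def generated_upfamily_def by blast
  have "{b. a * b \<in> E} \<in> \<B>" if "a \<in> A" for a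
  proof (rule upfamilies_mono[OF assms(2)])
    show "B a \<in> \<B>" using AB(2) that by blast
    show "B a \<subseteq> {b. a * b \<in> E}" using AB(3) that unfolding elt_set_times_def by blast
  qed
  then have "A \<subseteq> {a. {b. a * b \<in> E} \<in> \<B>}" by blast
  then show "{a. {b. a * b \<in> E} \<in> \<B>} \<in> \<A>"
    by (rule upfamilies_mono[OF assms(1) AB(1)])
next
  assume h: "{a. {b. a * b \<in> E} \<in> \<B>} \<in> \<A>"
  have "(\<Union>a\<in>{a. {b. a * b \<in> E} \<in> \<B>}. a *o {b. a * b \<in> E}) \<subseteq> E"
    unfolding elt_set_times_def by blast
  moreover have "(\<Union>a\<in>{a. {b. a * b \<in> E} \<in> \<B>}. a *o {b. a * b \<in> E})
      \<in> {\<Union>a\<in>A. a *o B a |A B. A \<in> \<A> \<and> (\<forall>a\<in>A. B a \<in> \<B>)}"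
    by (rule CollectI, rule exI[of _ "{a. {b. a * b \<in> E} \<in> \<B>}"],
        rule exI[of _ "\<lambda>a. {b. a * b \<in> E}"]) (simp add: h)
  ultimately show "E \<in> \<A> \<star> \<B>"
    unfolding up_star_def generated_upfamily_def by blast
qed

lemma star_in_upfamilies:
  assumes "\<A> \<in> upfamilies" "\<B> \<in> upfamilies"
  shows "\<A> \<star> \<B> \<in> upfamilies"
proof -
  obtain A B where "A \<in> \<A>" "B \<in> \<B>"
    using assms[THEN upfamilies_nonempty] by blast
  then have "(\<Union>a\<in>A. a *o B) \<in> {\<Union>a\<in>A. a *o B a |A B. A \<in> \<A> \<and> (\<forall>a\<in>A. B a \<in> \<B>)}"
    by (intro CollectI exI[of _ A] exI[of _ "\<lambda>_. B"]) simp
  then have "{\<Union>a\<in>A. a *o B a |A B. A \<in> \<A> \<and> (\<forall>a\<in>A. B a \<in> \<B>)} \<noteq> {}"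
    by (metis empty_iff)
  moreover have "{} \<notin> {\<Union>a\<in>A. a *o B a |A B. A \<in> \<A> \<and> (\<forall>a\<in>A. B a \<in> \<B>)}"
  proof
    assume "{} \<in> {\<Union>a\<in>A. a *o B a |A B. A \<in> \<A> \<and> (\<forall>a\<in>A. B a \<in> \<B>)}"
    then obtain A B where AB: "A \<in> \<A>" "\<forall>a\<in>A. B a \<in> \<B>" "(\<Union>a\<in>A. a *o B a) = {}"
      unfolding mem_Collect_eq by metis
    have "A \<noteq> {}" using AB(1) upfamilies_no_empty[OF assms(1)] by auto
    then obtain a where a: "a \<in> A" by blast
    then have "B a \<noteq> {}" using AB(2) upfamilies_no_empty[OF assms(2)] by auto
    then show False using a AB(3) unfolding elt_set_times_def by blast
  qed
  ultimately show ?thesis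
    unfolding up_star_def by (rule generated_upfamily_in_upfamilies)
qed

lemma star_assoc:
  assumes "\<A> \<in> upfamilies" "\<B> \<in> upfamilies" "\<C> \<in> upfamilies"
  shows "(\<A> \<star> \<B>) \<star> \<C> = \<A> \<star> (\<B> \<star> \<C>)"
  by (rule set_eqI) (simp add: assms mem_star_iff star_in_upfamilies mult.assoc)

lemma maximal_linked_iff_self_dual:
  "F \<in> maximal_linked_upfamilies \<longleftrightarrow> F \<in> upfamilies \<and> (\<forall>E. E \<in> F \<longleftrightarrow> - E \<notin> F)"
proof
  assume h: "F \<in> maximal_linked_upfamilies"
  then have up: "F \<in> upfamilies" and l: "linked F"
    and mx: "\<And>G. G \<in> upfamilies \<Longrightarrow> linked G \<Longrightarrow> F \<subseteq> G \<Longrightarrow> G = F"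
    unfolding maximal_linked_upfamilies_def by auto
  have "E \<in> F" if n: "- E \<notin> F" for E
  proof -
    have meet: "A \<inter> E \<noteq> {}" if "A \<in> F" for A
      using that n upfamilies_mono[OF up, of A "- E"] by blast
    have "E \<noteq> {}" using meet upfamilies_nonempty[OF up] by blast
    define G where "G = generated_upfamily (insert E F)"
    have "G \<in> upfamilies" unfolding G_def
      using \<open>E \<noteq> {}\<close> up by (intro generated_upfamily_in_upfamilies) (auto simp: upfamilies_def)
    moreover have "linked G"
    proof -
      have "C \<inter> D \<noteq> {}" if "C \<in> G" "D \<in> G" for C D
      proof -
        have "\<exists>A\<in>insert E F. A \<subseteq> C" "\<exists>B\<in>insert E F. B \<subseteq> D"
          using that unfolding G_def generated_upfamily_def mem_Collect_eq by this+
        then obtain A B where AB: "A \<in> insert E F" "A \<subseteq> C" "B \<in> insert E F" "B \<subseteq> D"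
          by (elim bexE)
        have "A \<inter> B \<noteq> {}"
          using AB(1,3) meet[of A] meet[of B] l \<open>E \<noteq> {}\<close>
          unfolding linked_def by (auto simp: Int_commute)
        then show ?thesis using AB(2,4) by blast
      qed
      then show ?thesis unfolding linked_def by simp
    qed
    moreover have "F \<subseteq> G" "E \<in> G" unfolding G_def generated_upfamily_def by auto
    ultimately show ?thesis using mx by blast
  qed
  moreover have "- E \<notin> F" if "E \<in> F" for E
    using that l unfolding linked_def by blast
  ultimately show "F \<in> upfamilies \<and> (\<forall>E. E \<in> F \<longleftrightarrow> - E \<notin> F)"
    using up by (intro conjI allI iffI)
next
  assume h: "F \<in> upfamilies \<and> (\<forall>E. E \<in> F \<longleftrightarrow> - E \<notin> F)"
  have "linked F"
    unfolding linked_def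
  proof (intro ballI notI)
    fix A B assume "A \<in> F" "B \<in> F" "A \<inter> B = {}"
    then have "- A \<in> F" using h upfamilies_mono[of F B "- A"] by blast
    then show False using h \<open>A \<in> F\<close> by blast
  qed
  moreover have "G = F" if "linked G" "F \<subseteq> G" for G
  proof
    show "G \<subseteq> F"
    proof
      fix E assume "E \<in> G"
      then have "- E \<notin> G" using that(1) unfolding linked_def by blast
      then show "E \<in> F" using h that(2) by blast
    qed
  qed (rule that(2))
  ultimately show "F \<in> maximal_linked_upfamilies"
    using h unfolding maximal_linked_upfamilies_def by simp
qed

lemma maximal_linked_star:
  assumes "\<A> \<in> maximal_linked_upfamilies" "\<B> \<in> maximal_linked_upfamilies"
  shows "\<A> \<star> \<B> \<in> maximal_linked_upfamilies"
proof -
  from assms have up: "\<A> \<in> upfamilies" "\<B> \<in> upfamilies"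
    and sd: "\<And>E. E \<in> \<A> \<longleftrightarrow> - E \<notin> \<A>" "\<And>E. E \<in> \<B> \<longleftrightarrow> - E \<notin> \<B>"
    unfolding maximal_linked_iff_self_dual by blast+
  have "E \<in> \<A> \<star> \<B> \<longleftrightarrow> - E \<notin> \<A> \<star> \<B>" for E
  proof -
    have "{a. {b. a * b \<in> - E} \<in> \<B>} = {a. - {b. a * b \<in> E} \<in> \<B>}"
      by (simp add: Collect_neg_eq)
    also have "\<dots> = - {a. {b. a * b \<in> E} \<in> \<B>}" using sd(2) by blast
    finally show ?thesis
      using sd(1)[of "{a. {b. a * b \<in> E} \<in> \<B>}"] unfolding mem_star_iff[OF up] by simp
  qed
  then show ?thesis
    unfolding maximal_linked_iff_self_dual using star_in_upfamilies[OF up] by blast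
qed

lemma finitely_supported_iff:
  assumes "F \<in> upfamilies"
  shows "finitely_supported F \<longleftrightarrow>
    (\<exists>S. finite S \<and> (\<forall>E\<in>F. E \<inter> S \<in> F))"
proof
  assume "finitely_supported F"
  then obtain G where G: "finite G" "\<forall>A\<in>G. finite A" "F = generated_upfamily G"
    unfolding finitely_supported_def by blast
  have "E \<inter> \<Union>G \<in> F" if "E \<in> F" for E
  proof -
    have "\<exists>A\<in>G. A \<subseteq> E"
      using that unfolding G(3) generated_upfamily_def mem_Collect_eq .
    then show ?thesis unfolding G(3) generated_upfamily_def by auto
  qed
  moreover have "finite (\<Union>G)" using G(1,2) by simp
  ultimately show "\<exists>S. finite S \<and> (\<forall>E\<in>F. E \<inter> S \<in> F)" by metis
next
  assume "\<exists>S. finite S \<and> (\<forall>E\<in>F. E \<inter> S \<in> F)"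
  then obtain S where S: "finite S" "\<forall>E\<in>F. E \<inter> S \<in> F" by blast
  have "finite (F \<inter> Pow S)" using S(1) by simp
  moreover have "F \<inter> Pow S \<noteq> {}" using S(2) upfamilies_nonempty[OF assms] by blast
  moreover have "\<forall>A\<in>F \<inter> Pow S. finite A \<and> A \<noteq> {}"
    using S(1) upfamilies_no_empty[OF assms] by (auto intro: finite_subset)
  moreover have "F = generated_upfamily (F \<inter> Pow S)"
  proof (rule set_eqI)
    fix E
    have "E \<inter> S \<in> F \<inter> Pow S" if "E \<in> F" using that S(2) by simp
    then show "E \<in> F \<longleftrightarrow> E \<in> generated_upfamily (F \<inter> Pow S)"
      unfolding generated_upfamily_def mem_Collect_eq
      using upfamilies_mono[OF assms, of _ E] by (metis Int_iff Int_lower1)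
  qed
  ultimately show "finitely_supported F" unfolding finitely_supported_def by blast
qed

lemma fs_maximal_linked_star:
  assumes "\<A> \<in> fs_maximal_linked_upfamilies" "\<B> \<in> fs_maximal_linked_upfamilies"
  shows "\<A> \<star> \<B> \<in> fs_maximal_linked_upfamilies"
proof -
  from assms have ml: "\<A> \<in> maximal_linked_upfamilies" "\<B> \<in> maximal_linked_upfamilies"
    and fs: "finitely_supported \<A>" "finitely_supported \<B>"
    unfolding fs_maximal_linked_upfamilies_def by auto
  from ml have up: "\<A> \<in> upfamilies" "\<B> \<in> upfamilies"
    unfolding maximal_linked_upfamilies_def by auto
  obtain S where S: "finite S" "\<And>E. E \<in> \<A> \<Longrightarrow> E \<inter> S \<in> \<A>"
    using fs(1) finitely_supported_iff[OF up(1)] by blast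
  obtain T where T: "finite T" "\<And>E. E \<in> \<B> \<Longrightarrow> E \<inter> T \<in> \<B>"
    using fs(2) finitely_supported_iff[OF up(2)] by blast
  have "E \<inter> (S * T) \<in> \<A> \<star> \<B>" if "E \<in> \<A> \<star> \<B>" for E
  proof -
    have "{a. {b. a * b \<in> E} \<in> \<B>} \<inter> S \<in> \<A>"
      using that up S(2) by (simp add: mem_star_iff)
    moreover have "{b. a * b \<in> E \<inter> (S * T)} \<in> \<B>" if a: "{b. a * b \<in> E} \<in> \<B>" "a \<in> S" for a
    proof (rule upfamilies_mono[OF up(2) T(2)[OF a(1)]])
      show "{b. a * b \<in> E} \<inter> T \<subseteq> {b. a * b \<in> E \<inter> (S * T)}" using a(2) by auto
    qed
    ultimately have "{a. {b. a * b \<in> E \<inter> (S * T)} \<in> \<B>} \<in> \<A>"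
      by (elim upfamilies_mono[OF up(1)]) blast
    then show ?thesis using up by (simp add: mem_star_iff)
  qed
  moreover have "finite (S * T)" using S(1) T(1) by (simp add: finite_set_times)
  ultimately show ?thesis
    using maximal_linked_star[OF ml] finitely_supported_iff[OF star_in_upfamilies[OF up]]
    unfolding fs_maximal_linked_upfamilies_def by blast
qed

end

theory Submission
  imports Defs
begin

text \<open>A maximal linked upfamily contains exactly one of \<open>E\<close>, \<open>- E\<close>. Since \<open>\<A> \<odot> \<B>\<close> is always
  contained in the maximal linked upfamily \<open>\<A> \<star> \<B>\<close>, the two coincide iff \<open>\<A> \<odot> \<B>\<close> contains \<open>E\<close>
  or \<open>- E\<close> for each \<open>E\<close>. As \<open>X\<close> is commutative, this property alone is equivalent to
  supercommutativity. The six relations of condition (3) amount to \<open>x\<^sup>2 = x\<^sup>4\<close> or \<open>x\<^sup>4 = x\<^sup>5\<close>.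

  If \<open>x\<^sup>2 = x\<^sup>4\<close>, a product depends only on the parities of the exponents, so every \<open>\<A> \<odot> \<B>\<close>
  contains a singleton. If \<open>x\<^sup>4 = x\<^sup>5\<close>, then \<open>x\<^sup>4\<close> is a zero, the only products that can avoid it
  are \<open>x\<^sup>2\<close> and \<open>x\<^sup>3\<close>, and a case distinction applies. Otherwise let \<open>\<A> = \<B>\<close> be the family of
  all sets containing at least two of \<open>x, x\<^sup>2, x\<^sup>3\<close>: each product of two members contains \<open>x\<^sup>4\<close>
  as well as one of \<open>x\<^sup>2, x\<^sup>5\<close>, so neither \<open>{x\<^sup>4}\<close> nor its complement lies in \<open>\<A> \<odot> \<A>\<close>.\<close>

section \<open>Comparison of the two products on maximal linked upfamilies\<close>

lemma mem_up_prod_iff: "E \<in> \<A> \<odot> \<B> \<longleftrightarrow> (\<exists>A\<in>\<A>. \<exists>B\<in>\<B>. A * B \<subseteq> E)"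
  unfolding up_prod_def generated_upfamily_def by blast

text \<open>Constant choices \<open>B a = B\<close> are among those that define
  \<open>\<A> \<star> \<B>\<close>.\<close>

lemma up_prod_subset_star: "\<A> \<odot> \<B> \<subseteq> \<A> \<star> \<B>"
proof
  fix E assume "E \<in> \<A> \<odot> \<B>"
  then obtain A B where AB: "A \<in> \<A>" "B \<in> \<B>" "A * B \<subseteq> E"
    unfolding mem_up_prod_iff by blast
  have "(\<Union>a\<in>A. a *o B) \<subseteq> E"
    using AB(3) unfolding elt_set_times_def set_times_def by blast
  moreover have "(\<Union>a\<in>A. a *o B) \<in> {\<Union>a\<in>A. a *o B a |A B. A \<in> \<A> \<and> (\<forall>a\<in>A. B a \<in> \<B>)}"
    using AB(1,2) by (intro CollectI exI[of _ A] exI[of _ "\<lambda>_. B"]) simp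
  ultimately show "E \<in> \<A> \<star> \<B>"
    unfolding up_star_def generated_upfamily_def by blast
qed

lemma up_prod_commute:
  assumes "\<And>a b :: 'a::semigroup_mult. a * b = b * a"
  shows "\<A> \<odot> \<B> = \<B> \<odot> (\<A> :: 'a set set)"
proof -
  have *: "A * B = B * A" for A B :: "'a set"
    unfolding set_times_def using assms by blast
  have "\<A> \<odot> \<B> \<subseteq> \<B> \<odot> \<A>" for \<A> \<B> :: "'a set set"
  proof
    fix E assume "E \<in> \<A> \<odot> \<B>"
    then obtain A B where "A \<in> \<A>" "B \<in> \<B>" "B * A \<subseteq> E"
      unfolding mem_up_prod_iff by (metis *)
    then show "E \<in> \<B> \<odot> \<A>" unfolding mem_up_prod_iff by blast
  qed
  then show ?thesis by blast
qed

lemma maximal_linked_cases: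
  assumes "F \<in> maximal_linked_upfamilies" "- A \<subseteq> B"
  shows "A \<in> F \<or> B \<in> F"
  using assms upfamilies_mono[of F "- A" B] unfolding maximal_linked_iff_self_dual by blast

lemma maximal_linked_meet:
  assumes "F \<in> maximal_linked_upfamilies" "A \<in> F" "B \<in> F"
  shows "A \<inter> B \<noteq> {}"
  using assms unfolding maximal_linked_upfamilies_def linked_def by blast

lemma star_eq_up_prod_iff:
  assumes "\<A> \<in> maximal_linked_upfamilies" "\<B> \<in> maximal_linked_upfamilies"
  shows "\<A> \<star> \<B> = \<A> \<odot> \<B> \<longleftrightarrow> (\<forall>E. E \<in> \<A> \<odot> \<B> \<or> - E \<in> \<A> \<odot> \<B>)"
proof -
  have "E \<in> \<A> \<star> \<B> \<longleftrightarrow> - E \<notin> \<A> \<star> \<B>" for E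
    using maximal_linked_star[OF assms] unfolding maximal_linked_iff_self_dual by blast
  then show ?thesis using up_prod_subset_star[of \<A> \<B>] by blast
qed

text \<open>Commutativity gives the middle equality, and the last is the first with
  \<open>\<A>\<close> and \<open>\<B>\<close> exchanged, so one equation per ordered pair
  suffices.\<close>

lemma supercommutative_iff:
  fixes S :: "'a::semigroup_mult set set set"
  assumes "\<And>a b :: 'a. a * b = b * a" "S \<subseteq> maximal_linked_upfamilies"
  shows "supercommutative S \<longleftrightarrow> (\<forall>\<A>\<in>S. \<forall>\<B>\<in>S. \<forall>E. E \<in> \<A> \<odot> \<B> \<or> - E \<in> \<A> \<odot> \<B>)"
proof -
  have "supercommutative S \<longleftrightarrow> (\<forall>\<A>\<in>S. \<forall>\<B>\<in>S. \<A> \<star> \<B> = \<A> \<odot> \<B>)"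
    unfolding supercommutative_def using up_prod_commute[OF assms(1)] by metis
  also have "\<dots> \<longleftrightarrow> (\<forall>\<A>\<in>S. \<forall>\<B>\<in>S. \<forall>E. E \<in> \<A> \<odot> \<B> \<or> - E \<in> \<A> \<odot> \<B>)"
    using star_eq_up_prod_iff assms(2) by (intro ball_cong refl) blast
  finally show ?thesis .
qed

lemma supercommutative_subset: "supercommutative S \<Longrightarrow> T \<subseteq> S \<Longrightarrow> supercommutative T"
  unfolding supercommutative_def by blast

text \<open>The points \<open>a\<close>, \<open>b\<close>, \<open>c\<close> need not be distinct: majority voting is self-dual in any case.\<close>

definition majority :: "'a \<Rightarrow> 'a \<Rightarrow> 'a \<Rightarrow> 'a set set" where
  "majority a b c = {E. a \<in> E \<and> b \<in> E \<or> a \<in> E \<and> c \<in> E \<or> b \<in> E \<and> c \<in> E}"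

lemma majority_fs_maximal_linked: "majority a b c \<in> fs_maximal_linked_upfamilies"
proof -
  have up: "majority a b c \<in> upfamilies"
    unfolding upfamilies_def majority_def by blast
  moreover have "E \<in> majority a b c \<longleftrightarrow> - E \<notin> majority a b c" for E
    unfolding majority_def by blast
  moreover have "finitely_supported (majority a b c)"
    unfolding finitely_supported_iff[OF up]
    by (rule exI[of _ "{a, b, c}"]) (auto simp: majority_def)
  ultimately show ?thesis
    unfolding fs_maximal_linked_upfamilies_def maximal_linked_iff_self_dual by blast
qed

section \<open>Powers of the generator and necessity of the relations\<close>

lemma spow_shift:
  assumes "spow x n = spow x m" "n \<ge> 1" "m \<ge> 1"
  shows "spow x (n + k) = spow x (m + k)"
  using assms by (cases "k = 0") (simp_all add: spow_add)

lemma monogenic_commute: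
  assumes "(UNIV :: 'a::semigroup_mult set) = {spow x k |k. k \<ge> 1}"
  shows "a * b = b * (a :: 'a)"
proof -
  obtain i j where "a = spow x i" "i \<ge> 1" "b = spow x j" "j \<ge> 1"
    using assms by blast
  then show ?thesis using spow_add[of i j x] spow_add[of j i x] by (simp add: add.commute)
qed

lemma majority_up_prod_undecided:
  assumes "spow x 2 \<noteq> spow x 4" "spow x 4 \<noteq> spow x 5"
  defines "\<T> \<equiv> majority (spow x 1) (spow x 2) (spow x 3)"
  shows "{spow x 4} \<notin> \<T> \<odot> \<T>" "- {spow x 4} \<notin> \<T> \<odot> \<T>"
proof -
  have *: "spow x 4 \<in> A * B" "spow x 2 \<in> A * B \<or> spow x 5 \<in> A * B"
    if "A \<in> \<T>" "B \<in> \<T>" for A B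
  proof -
    have mem: "spow x (i + j) \<in> A * B" if "spow x i \<in> A" "spow x j \<in> B" "i \<ge> 1" "j \<ge> 1" for i j
      using that by (simp add: spow_add set_times_intro)
    \<comment> \<open>Pigeonhole: \<open>A\<close> and \<open>B\<close> each miss at most one of the
      three positions. The pairs (1,3), (2,2), (3,1) use each position once per factor, so at most
      two pairs are spoiled. The same holds below for (1,1), (2,3), (3,2).\<close>
    show "spow x 4 \<in> A * B"
      using that mem[of 1 3] mem[of 2 2] mem[of 3 1]
      unfolding \<T>_def majority_def by auto
    show "spow x 2 \<in> A * B \<or> spow x 5 \<in> A * B"
      using that mem[of 1 1] mem[of 2 3] mem[of 3 2]
      unfolding \<T>_def majority_def by (auto simp: numeral_2_eq_2)
  qed
  show "{spow x 4} \<notin> \<T> \<odot> \<T>" "- {spow x 4} \<notin> \<T> \<odot> \<T>"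
    unfolding mem_up_prod_iff using * assms(1,2) by (metis singletonD subsetD, metis ComplD singletonI subsetD)
qed

section \<open>Sufficiency of the two relations\<close>

lemma up_prod_decided_if_period_two:
  fixes x :: "'a::semigroup_mult"
  assumes gen: "(UNIV :: 'a set) = {spow x k |k. k \<ge> 1}"
    and rel: "spow x 2 = spow x 4"
    and ml: "\<A> \<in> maximal_linked_upfamilies" "\<B> \<in> maximal_linked_upfamilies"
  shows "(E :: 'a set) \<in> \<A> \<odot> \<B> \<or> - E \<in> \<A> \<odot> \<B>"
proof -
  \<comment> \<open>The two parity classes may overlap, as for \<open>x = x * x\<close>; what is
    used is that they cover X.\<close>
  define P where "P r = {spow x k |k. k \<ge> 1 \<and> k mod 2 = r}" for r :: nat
  have "- P 0 \<subseteq> P 1"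
  proof
    fix y assume y: "y \<in> - P 0"
    obtain k where "y = spow x k" "k \<ge> 1" using gen by blast
    with y show "y \<in> P 1" unfolding P_def by (cases "even k") (auto simp: mod2_eq_if)
  qed
  then have "P 0 \<in> F \<or> P 1 \<in> F" if "F \<in> maximal_linked_upfamilies" for F
    using maximal_linked_cases[OF that] by blast
  then obtain p q where pq: "P p \<in> \<A>" "P q \<in> \<B>" using ml by meson
  \<comment> \<open>Exponent 1 is excluded, since \<open>x\<close> may differ from its cube;
    exponents of products start at 2.\<close>
  have red: "spow x k = spow x (2 + k mod 2)" if "k \<ge> 2" for k
    using that
  proof (induction k rule: less_induct)
    case (less k)
    show ?case
    proof (cases "k < 4")
      case True
      then have "k = 2 + k mod 2" using less.prems by presburger
      then show ?thesis by (rule arg_cong)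
    next
      case False
      then have "2 + (k - 4) = k - 2" "4 + (k - 4) = k" by simp_all
      then have "spow x k = spow x (k - 2)"
        using spow_shift[OF rel, of "k - 4"] by simp
      also have "\<dots> = spow x (2 + (k - 2) mod 2)"
        using less.IH[of "k - 2"] False by simp
      finally show ?thesis using False by (simp add: mod_diff_left_eq le_mod_geq)
    qed
  qed
  have "P p * P q \<subseteq> {spow x (2 + (p + q) mod 2)}"
  proof
    fix y assume "y \<in> P p * P q"
    then obtain i j where ij: "i \<ge> 1" "i mod 2 = p" "j \<ge> 1" "j mod 2 = q"
      and "y = spow x i * spow x j"
      unfolding P_def set_times_def by blast
    then have "y = spow x (2 + (i + j) mod 2)"
      using red[of "i + j"] by (simp add: spow_add)
    also have "(i + j) mod 2 = (p + q) mod 2" using ij by (metis mod_add_eq)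
    finally show "y \<in> {spow x (2 + (p + q) mod 2)}" by simp
  qed
  then show ?thesis unfolding mem_up_prod_iff using pq by blast
qed

lemma up_prod_decided_if_nilpotent:
  fixes x :: "'a::semigroup_mult"
  assumes gen: "(UNIV :: 'a set) = {spow x k |k. k \<ge> 1}"
    and rel: "spow x 4 = spow x 5"
    and ml: "\<A> \<in> maximal_linked_upfamilies" "\<B> \<in> maximal_linked_upfamilies"
  shows "(E :: 'a set) \<in> \<A> \<odot> \<B> \<or> - E \<in> \<A> \<odot> \<B>"
proof -
  define x2 x3 z where "x2 = spow x 2" and "x3 = spow x 3" and "z = spow x 4"
  have zero: "spow x k = z" if "k \<ge> 4" for k
    using that
  proof (induction k rule: nat_induct_at_least)
    case (Suc k)
    then show ?case using spow_shift[OF rel, of "k - 4"] by simp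
  qed (simp add: z_def)
  have elems: "y \<in> {x, x2, x3, z}" for y
  proof -
    obtain k where k: "y = spow x k" "k \<ge> 1" using gen by blast
    then consider "k = 1" | "k = 2" | "k = 3" | "k \<ge> 4" by linarith
    then show ?thesis
      by cases (use k zero in \<open>auto simp: x2_def x3_def spow_1[simplified]\<close>)
  qed
  have s1: "x = spow x 1" by (simp add: spow_1[simplified])
  have xx: "x * x = x2" "x * x2 = x3" "x2 * x = x3"
    using spow_add[of 1 1 x] spow_add[of 1 2 x] spow_add[of 2 1 x] s1
    by (simp_all add: x2_def x3_def numeral_2_eq_2 numeral_3_eq_3)
  have prod: "spow x i * spow x j = z" if "i \<ge> 1" "j \<ge> 1" "i + j \<ge> 4" for i j
    using that by (simp add: spow_add[symmetric] zero)
  have zz: "x2 * x2 = z" "x * x3 = z" "x3 * x = z" "x2 * x3 = z" "x3 * x2 = z" "x3 * x3 = z"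
    "x * z = z" "z * x = z" "x2 * z = z" "z * x2 = z" "x3 * z = z" "z * x3 = z" "z * z = z"
    using prod[of 2 2] prod[of 1 3] prod[of 3 1] prod[of 2 3] prod[of 3 2] prod[of 3 3]
      prod[of 1 4] prod[of 4 1] prod[of 2 4] prod[of 4 2] prod[of 3 4] prod[of 4 3] prod[of 4 4]
    by (simp_all add: x2_def x3_def z_def spow_1[simplified])
  note tab = xx zz
  \<comment> \<open>No loss of generality: \<open>z\<close> lies in \<open>E\<close> or in
    \<open>- E\<close>, and the claim is symmetric in the two.\<close>
  have main: "E \<in> \<A> \<odot> \<B> \<or> - E \<in> \<A> \<odot> \<B>" if zE: "z \<in> E" for E
  proof -
    have prodI: "F \<in> \<A> \<odot> \<B>" if "A \<in> \<A>" "B \<in> \<B>" "A * B \<subseteq> F" for A B F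
      unfolding mem_up_prod_iff using that by blast
    have top: "{x, x2, x3, z} \<in> F" if "F \<in> maximal_linked_upfamilies" for F :: "'a set set"
    proof -
      have "- {x, x2, x3, z} \<subseteq> {}" using elems by blast
      from maximal_linked_cases[OF \<open>F \<in> maximal_linked_upfamilies\<close> this] show ?thesis
        using maximal_linked_meet[OF that, of "{}" "{}"] by auto
    qed
    have split3: "{x3, z} \<in> F \<or> {x, x2} \<in> F"
      if "F \<in> maximal_linked_upfamilies" for F :: "'a set set"
      by (rule maximal_linked_cases[OF that]) (use elems in blast)
    have split2: "{x2, x3, z} \<in> F \<or> {x} \<in> F"
      if "F \<in> maximal_linked_upfamilies" for F :: "'a set set"
      by (rule maximal_linked_cases[OF that]) (use elems in blast)
    have split1: "{x, x3, z} \<in> F \<or> {x2} \<in> F"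
      if "F \<in> maximal_linked_upfamilies" for F :: "'a set set"
      by (rule maximal_linked_cases[OF that]) (use elems in blast)
    note set_times_def[simp]
    have A3: ?thesis if "{x3, z} \<in> \<A>"
      by (intro disjI1 prodI[OF that top[OF ml(2)]]) (use zE in \<open>auto simp: tab\<close>)
    have B3: ?thesis if "{x3, z} \<in> \<B>"
      by (intro disjI1 prodI[OF top[OF ml(1)] that]) (use zE in \<open>auto simp: tab\<close>)
    consider "x2 \<in> E" "x3 \<in> E" | "x2 \<in> E" "x3 \<notin> E" | "x2 \<notin> E" "x3 \<in> E" | "x2 \<notin> E" "x3 \<notin> E"
      by blast
    then show ?thesis
    proof cases
      case 1
      show ?thesis
        by (intro disjI1 prodI[OF top[OF ml(1)] top[OF ml(2)]]) (use 1 zE in \<open>auto simp: tab\<close>)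
    next
      case 2
      \<comment> \<open>If \<open>x = x2\<close>, then \<open>x3 = x * x2 = x * x = x2\<close>, but
        only \<open>x2\<close> lies in \<open>E\<close>.\<close>
      have "x \<noteq> x2" using 2 xx by metis
      then have disj: "\<not> ({x} \<in> F \<and> {x2} \<in> F)"
        if "F \<in> maximal_linked_upfamilies" for F :: "'a set set"
        using maximal_linked_meet[OF that, of "{x}" "{x2}"] by blast
      \<comment> \<open>If the first case fails, one family contains \<open>{x2}\<close>, hence not
        \<open>{x}\<close>, hence \<open>{x2, x3, z}\<close>; the other contains
        \<open>{x2, x3, z}\<close> or \<open>{x}\<close>. The products lie in
        \<open>{x2, z}\<close>, \<open>{z}\<close>, \<open>{x3}\<close>,
        \<open>{x3}\<close>.\<close>
      consider "{x, x3, z} \<in> \<A>" "{x, x3, z} \<in> \<B>" | "{x2, x3, z} \<in> \<A>" "{x2, x3, z} \<in> \<B>"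
        | "{x} \<in> \<A>" "{x2} \<in> \<B>" | "{x2} \<in> \<A>" "{x} \<in> \<B>"
        using split1[OF ml(1)] split1[OF ml(2)] split2[OF ml(1)] split2[OF ml(2)]
          disj[OF ml(1)] disj[OF ml(2)] by blast
      then show ?thesis
      proof cases
        case 1
        show ?thesis by (intro disjI1 prodI[OF 1]) (use 2 zE in \<open>auto simp: tab\<close>)
      next
        case c: 2
        show ?thesis by (intro disjI1 prodI[OF c]) (use 2 zE in \<open>auto simp: tab\<close>)
      next
        case 3
        show ?thesis by (intro disjI2 prodI[OF 3]) (use 2 in \<open>auto simp: tab\<close>)
      next
        case 4
        show ?thesis by (intro disjI2 prodI[OF 4]) (use 2 in \<open>auto simp: tab\<close>)
      qed
    next
      case 3
      \<comment> \<open>A factor in \<open>{x2, x3, z}\<close> forces the product into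
        \<open>{x3, z}\<close>; otherwise \<open>{x} * {x} = {x2}\<close> avoids
        \<open>E\<close>.\<close>
      consider "{x2, x3, z} \<in> \<A>" | "{x2, x3, z} \<in> \<B>" | "{x} \<in> \<A>" "{x} \<in> \<B>"
        using split2 ml by blast
      then show ?thesis
      proof cases
        case 1
        show ?thesis by (intro disjI1 prodI[OF 1 top[OF ml(2)]]) (use 3 zE in \<open>auto simp: tab\<close>)
      next
        case 2
        show ?thesis by (intro disjI1 prodI[OF top[OF ml(1)] 2]) (use 3 zE in \<open>auto simp: tab\<close>)
      next
        case c: 3
        show ?thesis by (intro disjI2 prodI[OF c]) (use 3 in \<open>auto simp: tab\<close>)
      qed
    next
      case 4
      \<comment> \<open>Without \<open>{x3, z}\<close>, both families contain
        \<open>{x, x2}\<close>. Then either both contain \<open>{x2, x3, z}\<close>, with product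
        \<open>{z}\<close>, or one contains \<open>{x}\<close>, and
        \<open>{x} * {x, x2} = {x2, x3}\<close> avoids \<open>E\<close>.\<close>
      consider "{x3, z} \<in> \<A>" | "{x3, z} \<in> \<B>" | "{x2, x3, z} \<in> \<A>" "{x2, x3, z} \<in> \<B>"
        | "{x} \<in> \<A>" "{x, x2} \<in> \<B>" | "{x, x2} \<in> \<A>" "{x} \<in> \<B>"
        using split2 split3 ml by metis
      then show ?thesis
      proof cases
        case 1
        then show ?thesis by (rule A3)
      next
        case 2
        then show ?thesis by (rule B3)
      next
        case 3
        show ?thesis by (intro disjI1 prodI[OF 3]) (use zE in \<open>auto simp: tab\<close>)
      next
        case c: 4
        show ?thesis by (intro disjI2 prodI[OF c]) (use 4 in \<open>auto simp: tab\<close>)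
      next
        case 5
        show ?thesis by (intro disjI2 prodI[OF 5]) (use 4 in \<open>auto simp: tab\<close>)
      qed
    qed
  qed
  show ?thesis using main[of E] main[of "- E"] by auto
qed

text \<open>Multiplying by powers of \<open>x\<close> raises both exponents equally; this carries
  the other four relations to one of these two.\<close>

lemma relations_iff:
  "(\<exists>(n, m) \<in> {(1, 2), (1, 3), (2, 3), (2, 4), (3, 4), (4, 5)}. spow x n = spow x m)
     \<longleftrightarrow> spow x 2 = spow x 4 \<or> spow x 4 = spow x 5"
proof -
  have "spow x 2 = spow x 4" if "spow x 1 = spow x 2"
    using spow_shift[OF that, of 1] spow_shift[OF that, of 2] by (simp add: eval_nat_numeral)
  moreover have "spow x 2 = spow x 4" if "spow x 1 = spow x 3"
    using spow_shift[OF that, of 1] by (simp add: eval_nat_numeral)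
  moreover have "spow x 2 = spow x 4" if "spow x 2 = spow x 3"
    using spow_shift[OF that, of 1] that by simp
  moreover have "spow x 4 = spow x 5" if "spow x 3 = spow x 4"
    using spow_shift[OF that, of 1] by simp
  ultimately show ?thesis
    unfolding bex_simps prod.case by blast
qed

theorem theorem10p1:
  fixes x :: "'a::semigroup_mult"
  assumes monogenic: "(UNIV :: 'a set) = {spow x k |k. k \<ge> 1}"
  shows "(supercommutative (maximal_linked_upfamilies :: 'a set set set)
            \<longleftrightarrow> supercommutative (fs_maximal_linked_upfamilies :: 'a set set set))
       \<and> (supercommutative (fs_maximal_linked_upfamilies :: 'a set set set)
            \<longleftrightarrow> (\<exists>(n, m) \<in> {(1, 2), (1, 3), (2, 3), (2, 4), (3, 4), (4, 5)}. spow x n = spow x m))"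
proof -
  let ?ml = "maximal_linked_upfamilies :: 'a set set set"
  let ?fs = "fs_maximal_linked_upfamilies :: 'a set set set"
  have fs: "?fs \<subseteq> ?ml" unfolding fs_maximal_linked_upfamilies_def by blast
  note iff = supercommutative_iff[OF monogenic_commute[OF monogenic]]
  have "supercommutative ?fs" if "supercommutative ?ml"
    using supercommutative_subset[OF that fs] .
  \<comment> \<open>The majority family is finitely supported, so it already tests the smaller
    semigroup.\<close>
  moreover have "spow x 2 = spow x 4 \<or> spow x 4 = spow x 5" if "supercommutative ?fs"
    using bspec[OF bspec[OF that[unfolded iff[OF fs]] majority_fs_maximal_linked]
        majority_fs_maximal_linked] majority_up_prod_undecided[of x] by metis
  moreover have "supercommutative ?ml" if "spow x 2 = spow x 4 \<or> spow x 4 = spow x 5"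
    unfolding iff[OF subset_refl]
    using that
  proof
    assume "spow x 2 = spow x 4"
    then show "\<forall>\<A>\<in>?ml. \<forall>\<B>\<in>?ml. \<forall>E. E \<in> \<A> \<odot> \<B> \<or> - E \<in> \<A> \<odot> \<B>"
      by (intro ballI allI) (rule up_prod_decided_if_period_two[OF monogenic])
  next
    assume "spow x 4 = spow x 5"
    then show "\<forall>\<A>\<in>?ml. \<forall>\<B>\<in>?ml. \<forall>E. E \<in> \<A> \<odot> \<B> \<or> - E \<in> \<A> \<odot> \<B>"
      by (intro ballI allI) (rule up_prod_decided_if_nilpotent[OF monogenic])
  qed
  ultimately show ?thesis unfolding relations_iff by blast
qed

end
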